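(* For every integer $n\geq 1$, $\mathrm{ex}_{\mathcal{P}}(n,S_{3,4})\leq \frac{20}{7}n$.
   Context: All graphs are finite and simple. For a graph $F$, the planar Turán number $\mathrm{ex}_{\mathcal{P}}(n,F)$ is the maximum number of edges in an $n$-vertex planar graph that contains no subgraph isomorphic to $F$. For positive integers $m,k$, the double star $S_{m,k}$ is the tree obtained from an edge $xy$ (the backbone) by joining $x$ to $m$ new vertices and $y$ to $k$ further new vertices, all these $m+k$ vertices distinct. *)

theory Defs
  imports "HOL-Analysis.Analysis"
begin

definition simple_graph :: "'a set \<Rightarrow> 'a set set \<Rightarrow> bool" where
  "simple_graph V E \<longleftrightarrow> finite V \<and> (\<forall>e\<in>E. e \<subseteq> V \<and> card e = 2)"

definition planar :: "'a set \<Rightarrow> 'a set set \<Rightarrow> bool" where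
  "planar V E \<longleftrightarrow> (\<exists>(pos :: 'a \<Rightarrow> complex) (\<gamma> :: 'a set \<Rightarrow> real \<Rightarrow> complex).
      inj_on pos V \<and>
      (\<forall>e\<in>E. arc (\<gamma> e) \<and>
         (\<exists>u v. e = {u, v} \<and> pathstart (\<gamma> e) = pos u \<and> pathfinish (\<gamma> e) = pos v) \<and>
         path_image (\<gamma> e) \<inter> pos ` V \<subseteq> pos ` e) \<and>
      (\<forall>e\<in>E. \<forall>e'\<in>E. e \<noteq> e' \<longrightarrow> path_image (\<gamma> e) \<inter> path_image (\<gamma> e') \<subseteq> pos ` (e \<inter> e')))"

definition contains_subgraph :: "'a set \<Rightarrow> 'a set set \<Rightarrow> 'b set \<Rightarrow> 'b set set \<Rightarrow> bool" where
  "contains_subgraph V E VF EF \<longleftrightarrow>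
     (\<exists>f. inj_on f VF \<and> f ` VF \<subseteq> V \<and> (\<forall>e\<in>EF. f ` e \<in> E))"

definition double_star_V :: "nat \<Rightarrow> nat \<Rightarrow> nat set" where
  "double_star_V m k = {..<m + k + 2}"

definition double_star_E :: "nat \<Rightarrow> nat \<Rightarrow> nat set set" where
  "double_star_E m k = {{0, 1}} \<union> {{0, i} | i. 2 \<le> i \<and> i < m + 2}
                        \<union> {{1, i} | i. m + 2 \<le> i \<and> i < m + k + 2}"

text \<open>Planar Turan number ex_P(n,F): max number of edges of an n-vertex planar graph
with no subgraph isomorphic to F (vertices taken from nat w.l.o.g.).\<close>
definition planar_turan :: "nat \<Rightarrow> 'b set \<Rightarrow> 'b set set \<Rightarrow> nat" where
  "planar_turan n VF EF = Sup {card E | (V :: nat set) E.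
      simple_graph V E \<and> card V = n \<and> planar V E \<and> \<not> contains_subgraph V E VF EF}"

end

theory Submission
  imports Defs
begin

text \<open>
  Euler's inequality for topological drawings follows from the Jordan curve theorem (an edge closing
  a cycle creates a new face) and Janiszewski's theorem (an edge borders at most two faces). It
  yields at most \<open>3n - 6\<close> edges for planar graphs and at most \<open>2n\<close> for bipartite ones.

  In a graph without \<open>S\<^sub>3\<^sub>,\<^sub>4\<close> an edge \<open>xy\<close> with \<open>deg x \<ge> 4\<close> and \<open>deg y \<ge> 5\<close> has at least
  \<open>deg x + deg y - 8\<close> common neighbours. Hence the closed neighbourhood of a vertex of degree 7
  consists of 8 vertices meeting at most 21 edges, and is removed by induction. If no degree is 7,
  give each vertex \<open>v\<close> the charge \<open>deg v - 40/7\<close>. Vertices of degree at least 8 have only neighbours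
  of degree at most 3, and the bipartite bound absorbs their charge; a vertex of degree 6 has two
  neighbours of degree at most 5, each of which pays it 1/7. So the total charge is not positive.
\<close>

section \<open>Adding an arc to a compact set in the plane\<close>

text \<open>An arc is homeomorphic to \<open>{0..1}\<close>, so a nonempty open subset of its image
  would embed into the real line, against invariance of dimension.\<close>

lemma open_subset_arc_image_empty:
  fixes g :: "real \<Rightarrow> complex"
  assumes "arc g" "open U" "U \<subseteq> path_image g"
  shows "U = {}"
proof (rule ccontr)
  assume "U \<noteq> {}"
  obtain f where "homeomorphism {0..1} (path_image g) g f"
    using homeomorphism_arc[OF assms(1)] .
  then have f: "homeomorphism (path_image g) {0..1} f g" by (rule homeomorphism_symD)
  have "DIM(complex) \<le> DIM(real)"
  proof (rule invariance_of_dimension)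
    show "continuous_on U f"
      using f assms(3) continuous_on_subset homeomorphism_cont1 by blast
    show "inj_on f U"
      by (rule inj_on_inverseI[of _ g]) (use f assms(3) homeomorphism_apply1 in fastforce)
  qed fact+
  then show False by simp
qed

text \<open>A connected set that meets \<open>U\<close> and leaves it must cross
  \<open>frontier U\<close>, which stays removed. So \<open>U\<close> remains maximal when the rest
  of \<open>K\<close> is put back.\<close>

lemma component_of_smaller_complement:
  fixes K :: "'a::real_normed_vector set"
  assumes U: "U \<in> components (- K)" and "S \<subseteq> K" and fr: "frontier U \<subseteq> S"
  shows "U \<in> components (- S)"
  unfolding in_components_maximal
proof (intro conjI allI impI)
  show "U \<noteq> {}" "connected U" "U \<subseteq> - S"
    using U assms(2) by (auto simp: in_components_nonempty in_components_connected dest: in_components_subset)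
next
  fix T assume T: "T \<noteq> {} \<and> U \<subseteq> T \<and> T \<subseteq> - S \<and> connected T"
  have "T - U = {}"
  proof (rule ccontr)
    assume "T - U \<noteq> {}"
    moreover have "T \<inter> U \<noteq> {}" using T U in_components_nonempty by blast
    ultimately have "T \<inter> frontier U \<noteq> {}" using T connected_Int_frontier by blast
    then show False using T fr by blast
  qed
  then show "T = U" using T by blast
qed


text \<open>The complement of an arc is connected. Janiszewski's theorem is applied twice, first to
  the arc and \<open>K1\<close>, then to their union and \<open>K2\<close>; the intersections are
  the single points \<open>a\<close> and \<open>b\<close>, hence connected.\<close>

lemma connected_component_complement_add_bridge:
  fixes e :: "real \<Rightarrow> complex"
  assumes "compact K1" "compact K2" "K1 \<inter> K2 = {}" "arc e"
    and e1: "path_image e \<inter> K1 = {a}" and e2: "path_image e \<inter> K2 = {b}"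
    and xy: "connected_component (- (K1 \<union> K2)) x y" "x \<notin> path_image e" "y \<notin> path_image e"
  shows "connected_component (- (K1 \<union> K2 \<union> path_image e)) x y"
proof -
  have "connected (- path_image e)"
    using path_connected_arc_complement[OF \<open>arc e\<close>] path_connected_imp_connected by auto
  then have ce: "connected_component (- path_image e) x y"
    using xy by (simp add: connected_iff_connected_component)
  have c1: "connected_component (- K1) x y" and c2: "connected_component (- K2) x y"
    by (rule connected_component_of_subset[OF xy(1)], blast)+
  have "connected_component (- (path_image e \<union> K1)) x y"
    by (rule Janiszewski) (use assms ce c1 compact_arc_image compact_imp_closed in auto)
  then have "connected_component (- ((path_image e \<union> K1) \<union> K2)) x y"
    using c2 apply -
  proof (rule Janiszewski[rotated 3])
    show "compact (path_image e \<union> K1)" "closed K2"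
      using assms by (simp_all add: compact_Un compact_arc_image compact_imp_closed)
    have "(path_image e \<union> K1) \<inter> K2 = {b}" using assms(3) e2 by blast
    then show "connected ((path_image e \<union> K1) \<inter> K2)" by simp
  qed
  moreover have "(path_image e \<union> K1) \<union> K2 = K1 \<union> K2 \<union> path_image e" by blast
  ultimately show ?thesis by simp
qed


text \<open>A path in \<open>K\<close> between the ends of \<open>e\<close> can be taken to be an
  arc \<open>g\<close>, and \<open>e +++ g\<close> is then a Jordan curve. Its intersection with
  \<open>K\<close> is the image of \<open>g\<close>, which gives the connectedness that
  Janiszewski's theorem asks for.\<close>

lemma arc_closes_to_cycle:
  fixes e :: "real \<Rightarrow> complex"
  assumes "arc e" and e: "path_image e \<inter> K = {pathstart e, pathfinish e}"
    and pc: "path_component K (pathstart e) (pathfinish e)"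
  obtains c where "simple_path c" "pathfinish c = pathstart c" "path_image e \<subseteq> path_image c"
    "path_image c \<subseteq> K \<union> path_image e" "connected (K \<inter> path_image c)"
proof -
  let ?a = "pathstart e" and ?b = "pathfinish e"
  let ?P = "path_component_set K ?a"
  have "path_connected ?P" by simp
  moreover have "?a \<noteq> ?b" using arc_distinct_ends[OF \<open>arc e\<close>] by simp
  moreover have "?a \<in> ?P" "?b \<in> ?P" using pc path_component_mem(1)[OF pc] by (simp_all add: path_component_refl_eq)
  ultimately obtain g where g: "arc g" "path_image g \<subseteq> ?P" "pathstart g = ?b" "pathfinish g = ?a"
    unfolding path_connected_arcwise by metis
  have gK: "path_image g \<subseteq> K" using g(2) path_component_subset by blast
  show ?thesis
  proof
    show "simple_path (e +++ g)"
      by (rule simple_path_join_loop) (use assms g gK in auto)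
    show "pathfinish (e +++ g) = pathstart (e +++ g)" by (simp add: g)
    have pi: "path_image (e +++ g) = path_image e \<union> path_image g"
      by (simp add: g path_image_join)
    then show "path_image e \<subseteq> path_image (e +++ g)"
      "path_image (e +++ g) \<subseteq> K \<union> path_image e" using gK by auto
    have "{?a,?b} \<subseteq> path_image g" using g(3,4) pathstart_in_path_image pathfinish_in_path_image by (metis empty_subsetI insert_subset)
    then have "K \<inter> path_image (e +++ g) = path_image g" using pi gK e by blast
    then show "connected (K \<inter> path_image (e +++ g))" using g(1) connected_arc_image by simp
  qed
qed


text \<open>Each piece either lies in the path component of \<open>a\<close> or misses it. So the
  path component and the remainder are both finite unions of compact pieces.\<close>

lemma path_component_finite_Union_separation:
  fixes F :: "complex set set"
  assumes "finite F" "\<And>S. S \<in> F \<Longrightarrow> compact S \<and> path_connected S" "a \<in> \<Union>F"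
  obtains K1 K2 where "compact K1" "compact K2" "K1 \<inter> K2 = {}" "\<Union>F = K1 \<union> K2"
    "K1 = path_component_set (\<Union>F) a"
proof -
  let ?P = "path_component_set (\<Union>F) a"
  define F1 where "F1 = {S \<in> F. S \<inter> ?P \<noteq> {}}"
  let ?F2 = "{S \<in> F. S \<inter> ?P = {}}"
  have in1: "S \<subseteq> ?P" if S: "S \<in> F1" for S
  proof -
    obtain x where x: "x \<in> S" "x \<in> ?P" using S F1_def by blast
    then have "S \<subseteq> path_component_set (\<Union>F) x"
      using S F1_def assms(2) by (intro path_component_maximal) auto
    then show ?thesis using path_component_eq[OF x(2)] by simp
  qed
  have "?P \<subseteq> \<Union>F" by (rule path_component_subset)
  then have P: "?P = \<Union>F1" using in1 F1_def by blast
  show ?thesis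
  proof
    show "compact ?P" unfolding P unfolding F1_def using assms by (intro compact_Union) auto
    show "compact (\<Union>?F2)" using assms by (intro compact_Union) auto
    show "?P \<inter> \<Union>?F2 = {}" by blast
    have "\<Union>F \<subseteq> ?P \<union> \<Union>?F2"
    proof
      fix x assume "x \<in> \<Union>F"
      then obtain S where S: "S \<in> F" "x \<in> S" by blast
      show "x \<in> ?P \<union> \<Union>?F2"
      proof (cases "S \<in> F1")
        case True
        then show ?thesis using in1 S(2) by blast
      next
        case False
        then have "S \<in> ?F2" using S(1) unfolding F1_def by blast
        then show ?thesis using S(2) by (rule UnI2[OF UnionI])
      qed
    qed
    then show "\<Union>F = ?P \<union> \<Union>?F2" using \<open>?P \<subseteq> \<Union>F\<close> by (intro equalityI Un_least Union_mono) auto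
  qed (rule refl)
qed


text \<open>This replaces the statement that an edge has only two sides: if the arc closes up to a Jordan
  curve inside the drawing, Janiszewski's theorem shows that a face near the arc is determined by
  the side of the curve it lies on; otherwise the arc is a bridge and only one face is near it.\<close>
lemma components_touching_arc:
  fixes e :: "real \<Rightarrow> complex"
  assumes fin: "finite F" and F: "\<And>S. S \<in> F \<Longrightarrow> compact S \<and> path_connected S"
    and "arc e" and e: "path_image e \<inter> \<Union>F = {pathstart e, pathfinish e}"
  defines "T \<equiv> {U \<in> components (- (\<Union>F \<union> path_image e)).
                 frontier U \<inter> (path_image e - {pathstart e, pathfinish e}) \<noteq> {}}"
  shows "finite T" and "card T \<le> 2"
proof -
  let ?K = "\<Union>F" and ?e = "path_image e" and ?a = "pathstart e" and ?b = "pathfinish e"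
  let ?eo = "?e - {?a,?b}"
  have cK: "compact ?K" using fin F by blast
  have conneo: "connected ?eo"
    using \<open>arc e\<close> arc_imp_simple_path connected_simple_path_endless by blast
  have eoK: "?eo \<inter> ?K = {}" using e by blast
  \<comment> \<open>A small disc around \<open>q\<close> avoids the drawing without
    \<open>e\<close>, so it links \<open>U\<close> to \<open>q\<close> there.\<close>
  have near: "connected_component (- ?K) x q"
    if "U \<in> T" "x \<in> U" "q \<in> frontier U" "q \<in> ?eo" for U x q
  proof -
    have "open (- ?K)" "q \<in> - ?K" using cK compact_imp_closed eoK that by auto
    then obtain r where r: "r > 0" "ball q r \<subseteq> - ?K" using openE by blast
    have "q \<in> closure U" using that frontier_def by (metis DiffE)
    then obtain z where z: "z \<in> U" "z \<in> ball q r"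
      using r(1) by (meson centre_in_ball closure_iff_nhds_not_empty disjoint_iff open_ball subset_refl)
    have "U \<in> components (- (?K \<union> ?e))" using that(1) T_def by simp
    then have "connected U" "U \<subseteq> - (?K \<union> ?e)"
      by (rule in_components_connected, rule in_components_subset)
    then have "connected (U \<union> ball q r)"
      using z by (intro connected_Un) auto
    moreover have "U \<union> ball q r \<subseteq> - ?K" using r \<open>U \<subseteq> - (?K \<union> ?e)\<close> by blast
    moreover have "x \<in> U \<union> ball q r" "q \<in> U \<union> ball q r" using that r by auto
    ultimately show ?thesis unfolding connected_component_def by blast
  qed
  \<comment> \<open>The open arc itself joins \<open>q\<close> to \<open>q'\<close> in the
    complement of the other pieces, so all faces touching it merge once \<open>e\<close> is
    deleted.\<close>
  have same: "connected_component (- ?K) x y"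
    if UV: "U \<in> T" "U' \<in> T" and "x \<in> U" "y \<in> U'" for U U' x y
  proof -
    obtain q where q: "q \<in> frontier U" "q \<in> ?eo" using UV T_def by auto
    obtain q' where q': "q' \<in> frontier U'" "q' \<in> ?eo" using UV T_def by auto
    have "connected_component (- ?K) q q'"
      using conneo eoK q q' unfolding connected_component_def by blast
    then show ?thesis using near[OF UV(1) _ q] near[OF UV(2) _ q'] that
      by (meson connected_component_sym connected_component_trans)
  qed
  have eq: "U = U'" if UV: "U \<in> T" "U' \<in> T" and "x \<in> U" "y \<in> U'" and c: "connected_component (- (?K \<union> ?e)) x y" for U U' x y
  proof -
    obtain C where C: "connected C" "C \<subseteq> - (?K \<union> ?e)" "x \<in> C" "y \<in> C"
      using c unfolding connected_component_def by blast
    have UC: "U \<in> components (- (?K \<union> ?e))" "U' \<in> components (- (?K \<union> ?e))" using UV T_def by simp_all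
    have "C \<subseteq> U" using components_maximal[OF UC(1) C(1,2)] C(3) that(3) by blast
    then have "U \<inter> U' \<noteq> {}" using C(4) that(4) by blast
    then show ?thesis using components_eq[OF UC] by blast
  qed
  \<comment> \<open>An injection into the two-element type yields finiteness and the bound 2
    together. In the cyclic case it records the side of the Jordan curve; in the bridge case it is
    constant, so at most one face touches the arc.\<close>
  have "\<exists>f :: complex set \<Rightarrow> bool. inj_on f T"
  proof (cases "path_component ?K ?a ?b")
    case True
    then obtain c where c: "simple_path c" "pathfinish c = pathstart c" "?e \<subseteq> path_image c"
      "path_image c \<subseteq> ?K \<union> ?e" "connected (?K \<inter> path_image c)"
      using arc_closes_to_cycle[OF \<open>arc e\<close> e] by metis
    have Kc: "?K \<union> path_image c = ?K \<union> ?e" using c by blast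
    have J: "connected (inside (path_image c))" "connected (outside (path_image c))"
      "inside (path_image c) \<union> outside (path_image c) = - path_image c"
      using Jordan_inside_outside[OF c(1,2)] by simp_all
    define f where "f U = (U \<inter> inside (path_image c) \<noteq> {})" for U
    have "inj_on f T"
    proof (rule inj_onI)
      fix U U' assume UV: "U \<in> T" "U' \<in> T" and ff: "f U = f U'"
      have sub: "V \<subseteq> - path_image c" "V \<noteq> {}" if "V \<in> T" for V
        using that Kc T_def in_components_subset in_components_nonempty by blast+
      have "\<exists>x y. x \<in> U \<and> y \<in> U' \<and> connected_component (- path_image c) x y"
      proof (cases "f U")
        case True
        then obtain x y where "x \<in> U" "x \<in> inside (path_image c)" "y \<in> U'" "y \<in> inside (path_image c)"
          using ff unfolding f_def by blast
        moreover have "connected (inside (path_image c))" "inside (path_image c) \<subseteq> - path_image c"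
          using J by blast+
        ultimately show ?thesis unfolding connected_component_def by blast
      next
        case False
        then have "U \<inter> inside (path_image c) = {}" "U' \<inter> inside (path_image c) = {}" using ff f_def by auto
        then obtain x y where "x \<in> U" "x \<in> outside (path_image c)" "y \<in> U'" "y \<in> outside (path_image c)"
          using sub[OF UV(1)] sub[OF UV(2)] J(3) by blast
        moreover have "connected (outside (path_image c))" "outside (path_image c) \<subseteq> - path_image c"
          using J by blast+
        ultimately show ?thesis unfolding connected_component_def by blast
      qed
      then obtain x y where xy: "x \<in> U" "y \<in> U'" "connected_component (- path_image c) x y" by blast
      have "connected_component (- (?K \<union> path_image c)) x y"
        by (rule Janiszewski) (use cK c xy same[OF UV] in \<open>auto simp: closed_simple_path_image\<close>)
      then show "U = U'" using eq[OF UV xy(1,2)] Kc by simp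
    qed
    then show ?thesis by blast
  next
    case False
    have "?a \<in> ?K" using e by blast
    obtain K1 K2 where K: "compact K1" "compact K2" "K1 \<inter> K2 = {}" "?K = K1 \<union> K2"
      "K1 = path_component_set ?K ?a"
      using path_component_finite_Union_separation[OF fin F \<open>?a \<in> ?K\<close>] by metis
    have "?a \<in> K1" "?b \<notin> K1"
      unfolding K(5) using False \<open>?a \<in> ?K\<close> by (simp_all only: mem_Collect_eq path_component_refl_eq not_False_eq_True)
    moreover have "?e \<inter> K1 \<union> ?e \<inter> K2 = {?a, ?b}" using e K(4) by (simp flip: Int_Un_distrib)
    ultimately have ea: "?e \<inter> K1 = {?a}" "?e \<inter> K2 = {?b}" using K(3) by blast+
    have "inj_on (\<lambda>_. True) T"
    proof (rule inj_onI)
      fix U U' assume UV: "U \<in> T" "U' \<in> T"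
      then obtain x y where xy: "x \<in> U" "y \<in> U'" using T_def in_components_nonempty by blast
      then have "x \<in> - (?K \<union> ?e)" "y \<in> - (?K \<union> ?e)"
        using UV T_def in_components_subset[of U] in_components_subset[of U'] by blast+
      then have "x \<notin> ?e" "y \<notin> ?e" by simp_all
      then have "connected_component (- (?K \<union> ?e)) x y"
        using connected_component_complement_add_bridge[OF K(1-3) \<open>arc e\<close> ea, of x y] same[OF UV xy] K(4) by simp
      then show "U = U'" using eq[OF UV xy] by simp
    qed
    then show ?thesis by blast
  qed
  then obtain f :: "complex set \<Rightarrow> bool" where f: "inj_on f T" by blast
  show "finite T" using inj_on_finite[OF f, of UNIV] by simp
  have "card T \<le> card (UNIV :: bool set)" using card_inj_on_le[OF f, of UNIV] by simp
  then show "card T \<le> 2" by simp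
qed


text \<open>Each component after the addition lies in a unique component before it. This map is
  onto, because a component of \<open>- K\<close> is open and no arc covers it. If \<open>e\<close>
  closes a Jordan curve, faces on both sides of the curve have the same image, so the map is not
  injective.\<close>

lemma components_add_arc:
  fixes e :: "real \<Rightarrow> complex"
  assumes K: "compact K" and "arc e" and e: "path_image e \<inter> K = {pathstart e, pathfinish e}"
    and fin: "finite (components (- (K \<union> path_image e)))"
  shows "card (components (- K)) \<le> card (components (- (K \<union> path_image e)))"
    and "path_component K (pathstart e) (pathfinish e) \<Longrightarrow>
         card (components (- K)) < card (components (- (K \<union> path_image e)))"
proof -
  let ?e = "path_image e" and ?C = "components (- (K \<union> path_image e))"
  define \<phi> where "\<phi> U = (SOME W. W \<in> components (- K) \<and> U \<subseteq> W)" for U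
  have \<phi>: "\<phi> U \<in> components (- K)" "U \<subseteq> \<phi> U" if "U \<in> ?C" for U
  proof -
    have "U \<subseteq> - K" "U \<noteq> {}" "connected U"
      using that in_components_subset in_components_nonempty in_components_connected by blast+
    then have "\<exists>W. W \<in> components (- K) \<and> U \<subseteq> W" by (intro exists_component_superset) auto
    then have "\<phi> U \<in> components (- K) \<and> U \<subseteq> \<phi> U" unfolding \<phi>_def by (rule someI_ex)
    then show "\<phi> U \<in> components (- K)" "U \<subseteq> \<phi> U" by auto
  qed
  have \<phi>eq: "\<phi> U = W" if "U \<in> ?C" "W \<in> components (- K)" "x \<in> U" "x \<in> W" for U W x
    using that \<phi>[OF that(1)] components_eq by blast
  have surj: "\<phi> ` ?C = components (- K)"
  proof (intro equalityI subsetI)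
    fix W assume W: "W \<in> components (- K)"
    have "open W" using W K compact_imp_closed open_Compl open_components by blast
    then have "\<not> W \<subseteq> ?e" using open_subset_arc_image_empty[OF \<open>arc e\<close>] W in_components_nonempty by blast
    then obtain x where x: "x \<in> W" "x \<notin> ?e" by blast
    then have "x \<in> - (K \<union> ?e)" using W in_components_subset by blast
    then obtain U where "U \<in> ?C" "x \<in> U" by (metis UnionE Union_components)
    then show "W \<in> \<phi> ` ?C" using \<phi>eq W x by blast
  qed (use \<phi> in auto)
  show "card (components (- K)) \<le> card ?C" using surj card_image_le[OF fin, of \<phi>] by simp
  assume pc: "path_component K (pathstart e) (pathfinish e)"
  obtain c where c: "simple_path c" "pathfinish c = pathstart c" "?e \<subseteq> path_image c"
      "path_image c \<subseteq> K \<union> ?e"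
    using arc_closes_to_cycle[OF \<open>arc e\<close> e pc] by metis
  have J: "open (inside (path_image c))" "open (outside (path_image c))"
    "inside (path_image c) \<inter> outside (path_image c) = {}"
    "frontier (inside (path_image c)) = path_image c"
    "frontier (outside (path_image c)) = path_image c"
    using Jordan_inside_outside[OF c(1,2)] by simp_all
  have "?e - {pathstart e, pathfinish e} \<noteq> {}"
    using \<open>arc e\<close> arc_imp_simple_path nonempty_simple_path_endless by blast
  \<comment> \<open>A disc around an inner point \<open>p\<close> of \<open>e\<close> lies in a
    single component \<open>W\<close> of \<open>- K\<close>.\<close>
  then obtain p where p: "p \<in> ?e" "p \<notin> K" using e by blast
  have "open (- K)" using K compact_imp_closed by blast
  then obtain r where r: "r > 0" "ball p r \<subseteq> - K" using p openE by (metis ComplI)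
  obtain W where W: "W \<in> components (- K)" "ball p r \<subseteq> W"
    using exists_component_superset[OF r(2)] r(1) by (metis ComplI connected_ball emptyE p(2))
  \<comment> \<open>\<open>p\<close> is on the frontier of both sides of the curve, so either side
    meets the disc in a nonempty open set, which \<open>e\<close> cannot cover.\<close>
  have *: "\<exists>U x. U \<in> ?C \<and> \<phi> U = W \<and> x \<in> U \<and> x \<in> I"
    if "open I" "frontier I = path_image c" for I
  proof -
    have "p \<in> closure I" using p c that frontier_def by blast
    then have "I \<inter> ball p r \<noteq> {}"
      by (metis Int_commute centre_in_ball open_Int_closure_eq_empty open_ball r(1) disjoint_iff)
    moreover have "open (I \<inter> ball p r)" using that by blast
    ultimately have "\<not> I \<inter> ball p r \<subseteq> ?e" using open_subset_arc_image_empty[OF \<open>arc e\<close>] by blast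
    then obtain x where x: "x \<in> I" "x \<in> ball p r" "x \<notin> ?e" by blast
    then have "x \<in> - (K \<union> ?e)" using r by blast
    then obtain U where "U \<in> ?C" "x \<in> U" by (metis UnionE Union_components)
    then show ?thesis using \<phi>eq W x by blast
  qed
  obtain U x where U: "U \<in> ?C" "\<phi> U = W" "x \<in> U" "x \<in> inside (path_image c)" using * J by metis
  obtain U' y where U': "U' \<in> ?C" "\<phi> U' = W" "y \<in> U'" "y \<in> outside (path_image c)" using * J by metis
  have "U \<noteq> U'"
  proof
    assume "U = U'"
    then have "connected U" "U \<inter> inside (path_image c) \<noteq> {}" "U - inside (path_image c) \<noteq> {}"
      using U U' J(3) in_components_connected by blast+
    then have "U \<inter> path_image c \<noteq> {}" using connected_Int_frontier J(4) by metis
    then show False using c(4) U(1) in_components_subset by blast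
  qed
  then have "\<not> inj_on \<phi> ?C" using U U' by (metis inj_onD)
  then have "card (\<phi> ` ?C) \<noteq> card ?C" using eq_card_imp_inj_on[OF fin, of \<phi>] by metis
  then show "card (components (- K)) < card ?C"
    using surj card_image_le[OF fin, of \<phi>] by simp
qed

section \<open>Euler's inequality\<close>

text \<open>Acyclicity, expressed by leaves: every nonempty subset has an edge with an endpoint in no other edge.\<close>
definition forest :: "'a set set \<Rightarrow> bool" where
  "forest S \<longleftrightarrow> (\<forall>T\<subseteq>S. T \<noteq> {} \<longrightarrow> (\<exists>e\<in>T. \<exists>v\<in>e. \<forall>f\<in>T. v \<in> f \<longrightarrow> f = e))"

locale plane_drawing =
  fixes V :: "'a set" and E :: "'a set set" and pos :: "'a \<Rightarrow> complex" and \<gamma> :: "'a set \<Rightarrow> real \<Rightarrow> complex"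
  assumes finite_V: "finite V"
    and edge_subset: "e \<in> E \<Longrightarrow> e \<subseteq> V"
    and inj_pos: "inj_on pos V"
    and arc_edge: "e \<in> E \<Longrightarrow> arc (\<gamma> e)"
    and edge_ends: "e \<in> E \<Longrightarrow> \<exists>u v. e = {u, v} \<and> pathstart (\<gamma> e) = pos u \<and> pathfinish (\<gamma> e) = pos v"
    and edge_vertices: "e \<in> E \<Longrightarrow> path_image (\<gamma> e) \<inter> pos ` V \<subseteq> pos ` e"
    and edge_edge: "e \<in> E \<Longrightarrow> e' \<in> E \<Longrightarrow> e \<noteq> e' \<Longrightarrow>
      path_image (\<gamma> e) \<inter> path_image (\<gamma> e') \<subseteq> pos ` (e \<inter> e')"
begin

lemma finite_E: "finite E"
  using finite_V edge_subset by (meson Pow_iff finite_Pow_iff finite_subset subsetI)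

lemma edge_endsE:
  assumes "e \<in> E"
  obtains u v where "e = {u, v}" "u \<in> V" "v \<in> V" "u \<noteq> v"
    "pathstart (\<gamma> e) = pos u" "pathfinish (\<gamma> e) = pos v"
proof -
  obtain u v where uv: "e = {u, v}" "pathstart (\<gamma> e) = pos u" "pathfinish (\<gamma> e) = pos v"
    using edge_ends[OF assms] by blast
  moreover have "u \<in> V" "v \<in> V" using edge_subset[OF assms] uv(1) by simp_all
  moreover have "u \<noteq> v" using arc_distinct_ends[OF arc_edge[OF assms]] uv by metis
  ultimately show ?thesis using that by blast
qed

lemma edge_ends_image: "e \<in> E \<Longrightarrow> {pathstart (\<gamma> e), pathfinish (\<gamma> e)} = pos ` e"
  by (erule edge_endsE) simp

definition pieces :: "'a set set \<Rightarrow> complex set set" where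
  "pieces S = (\<lambda>v. {pos v}) ` V \<union> (\<lambda>e. path_image (\<gamma> e)) ` S"

text \<open>All vertices are included whatever \<open>S\<close> is, so deleting edges leaves the
  vertex set alone and isolated vertices count as components.\<close>

definition skeleton :: "'a set set \<Rightarrow> complex set" where
  "skeleton S = pos ` V \<union> (\<Union>e\<in>S. path_image (\<gamma> e))"

lemma Union_pieces: "\<Union>(pieces S) = skeleton S"
  unfolding pieces_def skeleton_def by auto

lemma finite_pieces: "S \<subseteq> E \<Longrightarrow> finite (pieces S)"
  unfolding pieces_def using finite_V finite_E finite_subset by blast

lemma pieces_path_connected:
  assumes "S \<subseteq> E" "P \<in> pieces S"
  shows "compact P \<and> path_connected P"
proof -
  from assms(2) consider v where "P = {pos v}" | e where "e \<in> S" "P = path_image (\<gamma> e)"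
    unfolding pieces_def by blast
  then show ?thesis
  proof cases
    case 2
    then have "arc (\<gamma> e)" using assms arc_edge by blast
    then show ?thesis using 2 compact_arc_image arc_imp_path path_connected_path_image by blast
  qed simp
qed

lemma compact_skeleton: "S \<subseteq> E \<Longrightarrow> compact (skeleton S)"
  using finite_pieces pieces_path_connected Union_pieces compact_Union by metis

lemma skeleton_insert: "skeleton (insert e S) = skeleton S \<union> path_image (\<gamma> e)"
  unfolding skeleton_def by auto

lemma edge_Int_skeleton:
  assumes "S \<subseteq> E" "e \<in> E - S"
  shows "path_image (\<gamma> e) \<inter> skeleton S = {pathstart (\<gamma> e), pathfinish (\<gamma> e)}"
proof
  have eE: "e \<in> E" using assms(2) by simp
  show "path_image (\<gamma> e) \<inter> skeleton S \<subseteq> {pathstart (\<gamma> e), pathfinish (\<gamma> e)}"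
    unfolding edge_ends_image[OF eE]
  proof
    fix z assume z: "z \<in> path_image (\<gamma> e) \<inter> skeleton S"
    then consider "z \<in> pos ` V" | f where "f \<in> S" "z \<in> path_image (\<gamma> f)"
      unfolding skeleton_def by blast
    then show "z \<in> pos ` e"
    proof cases
      case 1
      then show ?thesis using z edge_vertices[OF eE] by blast
    next
      case 2
      then have "f \<in> E" "e \<noteq> f" using assms by auto
      then show ?thesis using edge_edge[OF eE] 2 z by blast
    qed
  qed
  obtain u v where "u \<in> V" "v \<in> V" "pathstart (\<gamma> e) = pos u" "pathfinish (\<gamma> e) = pos v"
    using edge_endsE[OF eE] by metis
  then show "{pathstart (\<gamma> e), pathfinish (\<gamma> e)} \<subseteq> path_image (\<gamma> e) \<inter> skeleton S"
    using pathstart_in_path_image[of "\<gamma> e"] pathfinish_in_path_image[of "\<gamma> e"]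
    unfolding skeleton_def by auto
qed

abbreviation faces :: "'a set set \<Rightarrow> complex set set" where
  "faces S \<equiv> components (- skeleton S)"

text \<open>The endpoints are left out because a face may meet an edge in a common vertex without
  bordering it.\<close>

definition touches :: "complex set \<Rightarrow> 'a set \<Rightarrow> bool" where
  "touches U e \<longleftrightarrow> frontier U \<inter> (path_image (\<gamma> e) - {pathstart (\<gamma> e), pathfinish (\<gamma> e)}) \<noteq> {}"

lemma faces_touching_edge:
  assumes "S \<subseteq> E" "e \<in> E - S"
  shows "finite {U \<in> faces (insert e S). touches U e}" "card {U \<in> faces (insert e S). touches U e} \<le> 2"
  using components_touching_arc[of "pieces S" "\<gamma> e"] assms finite_pieces pieces_path_connected[OF assms(1)]
    arc_edge[of e] edge_Int_skeleton[OF assms]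
  unfolding touches_def skeleton_insert Union_pieces by auto

lemma frontier_face: "S \<subseteq> E \<Longrightarrow> U \<in> faces S \<Longrightarrow> frontier U \<subseteq> skeleton S"
  using frontier_of_components_closed_complement compact_skeleton compact_imp_closed by blast

text \<open>The frontier of \<open>U\<close> meets edges outside \<open>T\<close> only in their
  endpoints, which are vertices and belong to every skeleton.\<close>

lemma face_of_touched:
  assumes "S \<subseteq> E" "U \<in> faces S" "T \<subseteq> S" and T: "\<And>e. e \<in> S - T \<Longrightarrow> \<not> touches U e"
  shows "U \<in> faces T"
proof (rule component_of_smaller_complement[OF assms(2)])
  show "skeleton T \<subseteq> skeleton S" using assms(3) unfolding skeleton_def by blast
  show "frontier U \<subseteq> skeleton T"
  proof
    fix z assume z: "z \<in> frontier U"
    then have "z \<in> skeleton S" using frontier_face assms by blast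
    then consider "z \<in> pos ` V" | e where "e \<in> S" "z \<in> path_image (\<gamma> e)"
      unfolding skeleton_def by blast
    then show "z \<in> skeleton T"
    proof cases
      case 1
      then show ?thesis unfolding skeleton_def by blast
    next
      case 2
      show ?thesis
      proof (cases "e \<in> T")
        case True
        then show ?thesis using 2 unfolding skeleton_def by blast
      next
        case False
        then have "\<not> touches U e" using 2 T by blast
        then have "z \<in> {pathstart (\<gamma> e), pathfinish (\<gamma> e)}" using 2 z unfolding touches_def by blast
        then have "z \<in> pos ` e" using edge_ends_image 2 assms by blast
        then show ?thesis using edge_subset 2 assms unfolding skeleton_def by blast
      qed
    qed
  qed
qed

lemma connected_complement_vertices: "connected (- skeleton {})"
proof -
  have "countable (pos ` V)" using finite_V by (simp add: countable_finite)
  then have "path_connected (- (pos ` V))" by (intro path_connected_complement_countable) simp_all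
  then show ?thesis unfolding skeleton_def by (simp add: path_connected_imp_connected)
qed

lemma skeleton_complement_nonempty: "S \<subseteq> E \<Longrightarrow> - skeleton S \<noteq> {}"
  using compact_skeleton[of S] compact_imp_bounded not_bounded_UNIV by (metis Compl_empty_eq double_compl)

text \<open>After inserting \<open>e\<close>, a face either touches \<open>e\<close>, which happens
  for at most two, or was a face before.\<close>

lemma finite_faces: "S \<subseteq> E \<Longrightarrow> finite (faces S)"
proof (induction S rule: infinite_finite_induct)
  case (infinite S)
  then show ?case using finite_E finite_subset by blast
next
  case empty
  have "faces {} = {- skeleton {}}"
    using connected_complement_vertices skeleton_complement_nonempty by (simp add: components_eq_sing_iff)
  then show ?case by simp
next
  case (insert e S)
  have "faces (insert e S) \<subseteq> {U \<in> faces (insert e S). touches U e} \<union> faces S"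
  proof
    fix U assume U: "U \<in> faces (insert e S)"
    show "U \<in> {U \<in> faces (insert e S). touches U e} \<union> faces S"
    proof (cases "touches U e")
      case False
      then have "U \<in> faces S" using insert.prems U by (intro face_of_touched[OF insert.prems, of U S]) auto
      then show ?thesis by blast
    qed (use U in blast)
  qed
  moreover have "finite {U \<in> faces (insert e S). touches U e}"
    using faces_touching_edge(1)[of S e] insert by simp
  ultimately show ?case using insert finite_subset by (metis (no_types, lifting) finite_Un insert_subset)
qed

text \<open>The function \<open>l\<close> labels the vertices by connected components, so that \<open>card (l ` V)\<close> is the
  number of components in Euler's formula.\<close>
lemma euler_inequality_components:
  assumes "S \<subseteq> E"
  shows "\<exists>l :: 'a \<Rightarrow> 'a. (\<forall>x\<in>V. \<forall>y\<in>V. l x = l y \<longrightarrow> path_component (skeleton S) (pos x) (pos y)) \<and>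
           card S + card (l ` V) + 1 \<le> card V + card (faces S)"
  using assms
proof (induction S rule: infinite_finite_induct)
  case (infinite S)
  then show ?case using finite_E finite_subset by blast
next
  case empty
  have "faces {} = {- skeleton {}}"
    using connected_complement_vertices skeleton_complement_nonempty by (simp add: components_eq_sing_iff)
  moreover have "path_component (skeleton {}) (pos x) (pos x)" if "x \<in> V" for x
    using that unfolding skeleton_def by (simp add: path_component_refl)
  ultimately show ?case by (intro exI[of _ id]) auto
next
  case (insert e S)
  then obtain l :: "'a \<Rightarrow> 'a" where
    l: "\<And>x y. x \<in> V \<Longrightarrow> y \<in> V \<Longrightarrow> l x = l y \<Longrightarrow> path_component (skeleton S) (pos x) (pos y)"
    and card: "card S + card (l ` V) + 1 \<le> card V + card (faces S)" by auto
  have e: "e \<in> E" "S \<subseteq> E" "e \<in> E - S" using insert by auto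
  obtain u v where uv: "u \<in> V" "v \<in> V" "pathstart (\<gamma> e) = pos u" "pathfinish (\<gamma> e) = pos v"
    using edge_endsE[OF e(1)] by metis
  have fin: "finite (components (- (skeleton S \<union> path_image (\<gamma> e))))"
    using finite_faces[OF insert.prems] by (simp add: skeleton_insert)
  note add = components_add_arc[OF compact_skeleton[OF e(2)] arc_edge[OF e(1)] edge_Int_skeleton[OF e(2,3)] fin]
  have mono: "path_component (skeleton (insert e S)) a b" if "path_component (skeleton S) a b" for a b
    using that by (rule path_component_of_subset[rotated]) (simp add: skeleton_insert)
  have cS: "card (insert e S) = card S + 1" using insert by simp
  show ?case
  \<comment> \<open>An edge inside a component closes a cycle and creates a face. An edge between
    two components merges their labels, and the number of faces does not drop.\<close>
  proof (cases "l u = l v")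
    case True
    then have "card (faces S) < card (faces (insert e S))"
      using add(2) l[OF uv(1,2)] uv by (simp add: skeleton_insert)
    then show ?thesis using l mono card cS by (intro exI[of _ l]) auto
  next
    case False
    \<comment> \<open>The label of \<open>u\<close> is replaced by that of \<open>v\<close>, so one
      label disappears.\<close>
    define l' where "l' x = (if l x = l u then l v else l x)" for x
    have pe: "path_component (skeleton (insert e S)) (pos u) (pos v)"
      unfolding path_component_def
      using arc_imp_path[OF arc_edge[OF e(1)]] uv by (intro exI[of _ "\<gamma> e"]) (auto simp: skeleton_insert)
    have "l' ` V \<subseteq> l ` V - {l u}" unfolding l'_def using uv False by auto
    then have "card (l' ` V) \<le> card (l ` V - {l u})" using finite_V by (intro card_mono) auto
    moreover have "card (l ` V - {l u}) < card (l ` V)" using uv finite_V by (intro card_Diff1_less) auto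
    ultimately have c: "card (l' ` V) + 1 \<le> card (l ` V)" by simp
    have "path_component (skeleton (insert e S)) (pos x) (pos y)" if xy: "x \<in> V" "y \<in> V" "l' x = l' y" for x y
    proof -
      consider "l x = l y" | "l x = l u" "l y = l v" | "l x = l v" "l y = l u"
        using xy(3) unfolding l'_def by (auto split: if_splits)
      then show ?thesis
      proof cases
        case 1
        then show ?thesis using l mono xy by blast
      next
        case 2
        then show ?thesis using l[of x u] l[of v y] mono xy uv pe path_component_trans by metis
      next
        case 3
        then show ?thesis using l[of x v] l[of u y] mono xy uv pe path_component_trans path_component_sym by metis
      qed
    qed
    then show ?thesis using c card add(1) cS by (intro exI[of _ l']) (auto simp: skeleton_insert)
  qed
qed

lemma euler_inequality:
  assumes "V \<noteq> {}"
  shows "card E + 2 \<le> card V + card (faces E)"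
proof -
  obtain l :: "'a \<Rightarrow> 'a" where "card E + card (l ` V) + 1 \<le> card V + card (faces E)"
    using euler_inequality_components by blast
  moreover have "card (l ` V) \<ge> 1" using assms finite_V by (simp add: card_gt_0_iff Suc_le_eq)
  ultimately show ?thesis by linarith
qed

section \<open>Edges touched by a face, and double counting of incidences\<close>

text \<open>Induction by deleting an edge \<open>e\<close> with a leaf \<open>v\<close>: without
  \<open>e\<close> the point \<open>pos v\<close> is isolated, so \<open>e\<close> is a bridge from
  the rest of the drawing to \<open>{pos v}\<close> and does not separate the plane.\<close>

lemma connected_complement_forest:
  assumes "S \<subseteq> E" "forest S"
  shows "connected (- skeleton S)"
  using finite_subset[OF assms(1) finite_E] assms
proof (induction S rule: finite_psubset_induct)
  case (psubset S)
  show ?case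
  proof (cases "S = {}")
    case True
    then show ?thesis using connected_complement_vertices by simp
  next
    case False
    then have "\<exists>e\<in>S. \<exists>v\<in>e. \<forall>f\<in>S. v \<in> f \<longrightarrow> f = e"
      using psubset.prems(2) unfolding forest_def by simp
    then obtain e v where ev: "e \<in> S" "v \<in> e" "\<And>f. f \<in> S \<Longrightarrow> v \<in> f \<Longrightarrow> f = e"
      by blast
    have eE: "e \<in> E" using ev psubset by blast
    define S' where "S' = S - {e}"
    have S': "S' \<subset> S" "S' \<subseteq> E" "S = insert e S'"
      using ev(1) psubset.prems(1) unfolding S'_def by blast+
    have "forest S'" using psubset.prems(2) S'(1) unfolding forest_def by (meson psubset_imp_subset subset_trans)
    then have IH: "connected (- skeleton S')" using psubset.IH S' by blast
    obtain u where u: "e = {u, v}" "u \<noteq> v" "u \<in> V" "v \<in> V"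
      using edge_endsE[OF eE] ev(2) by (metis insert_commute insertE singletonD)
    define K1 where "K1 = pos ` (V - {v}) \<union> (\<Union>f\<in>S'. path_image (\<gamma> f))"
    have vf: "pos v \<notin> path_image (\<gamma> f)" if "f \<in> S'" for f
    proof
      assume "pos v \<in> path_image (\<gamma> f)"
      then have "pos v \<in> pos ` f" using edge_vertices[of f] that S' u by blast
      then have "v \<in> f" using inj_pos edge_subset[of f] that S' u by (metis inj_on_image_mem_iff subsetD)
      then show False using ev(3) that unfolding S'_def by blast
    qed
    have K12: "K1 \<union> {pos v} = skeleton S'" unfolding K1_def skeleton_def using u by auto
    have disj: "pos v \<notin> K1"
      unfolding K1_def using vf inj_pos u by (auto simp: inj_on_def)
    have eK: "path_image (\<gamma> e) \<inter> skeleton S' = {pos u, pos v}"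
      using edge_Int_skeleton[OF S'(2), of e] edge_ends_image[OF eE] eE u(1) unfolding S'_def by auto
    have uv: "pos u \<noteq> pos v" using inj_pos u by (auto simp: inj_on_def)
    have "compact K1" unfolding K1_def
    proof (intro compact_Un compact_UN)
      show "compact (pos ` (V - {v}))" using finite_V by (intro finite_imp_compact) simp
      show "finite S'" using S'(2) finite_E by (rule finite_subset)
      show "compact (path_image (\<gamma> f))" if "f \<in> S'" for f
        using that S'(2) by (intro compact_arc_image arc_edge) blast
    qed
    have e1: "path_image (\<gamma> e) \<inter> K1 = {pos u}" and e2: "path_image (\<gamma> e) \<inter> {pos v} = {pos v}"
      using eK K12 disj uv by blast+
    have sk: "skeleton S = K1 \<union> {pos v} \<union> path_image (\<gamma> e)"
      unfolding S'(3) skeleton_insert K12 by simp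
    show ?thesis
      unfolding connected_iff_connected_component
    proof (intro ballI)
      fix x y assume xy: "x \<in> - skeleton S" "y \<in> - skeleton S"
      then have "x \<in> - skeleton S'" "y \<in> - skeleton S'" "x \<notin> path_image (\<gamma> e)" "y \<notin> path_image (\<gamma> e)"
        unfolding S'(3) skeleton_insert by auto
      moreover have "connected_component (- (K1 \<union> {pos v})) x y"
        using IH calculation unfolding connected_iff_connected_component K12 by blast
      ultimately show "connected_component (- skeleton S) x y"
        unfolding sk using \<open>compact K1\<close> disj e1 e2 arc_edge[OF eE]
        by (intro connected_component_complement_add_bridge) auto
    qed
  qed
qed

text \<open>A face is also a face of the drawing consisting only of the edges it touches; if these formed
  a forest, the complement of that drawing would be connected.\<close>
lemma face_touches_many:
  assumes "U \<in> faces E" "card (faces E) \<ge> 2" and g: "\<And>S. S \<subseteq> E \<Longrightarrow> card S < g \<Longrightarrow> forest S"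
  shows "g \<le> card {e \<in> E. touches U e}"
proof (rule ccontr)
  let ?S = "{e \<in> E. touches U e}"
  assume "\<not> g \<le> card ?S"
  then have "forest ?S" by (intro g) auto
  then have con: "connected (- skeleton ?S)" by (intro connected_complement_forest) auto
  have "U \<in> faces ?S" using assms(1) by (intro face_of_touched[OF subset_refl, of U ?S]) auto
  moreover have "faces ?S = {- skeleton ?S}"
    using con skeleton_complement_nonempty[of ?S] by (simp add: components_eq_sing_iff)
  ultimately have "U = - skeleton ?S" by simp
  moreover have "U \<subseteq> - skeleton E" using assms(1) in_components_subset by blast
  moreover have "- skeleton E \<subseteq> - skeleton ?S" unfolding skeleton_def by blast
  \<comment> \<open>\<open>U\<close> fills the complement of the whole drawing, which contradicts
    the presence of two faces.\<close>
  ultimately have "- skeleton E = U" by blast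
  then have "faces E = {U}"
    using in_components_connected[OF assms(1)] in_components_nonempty[OF assms(1)] by (simp add: components_eq_sing_iff)
  then show False using assms(2) by simp
qed

text \<open>The number \<open>g\<close> acts as a lower bound for the girth. With at least two
  faces, every face touches at least \<open>g\<close> edges and every edge at most two faces, so
  \<open>g\<close> times the number of faces is at most \<open>2 * card E\<close>; Euler's
  inequality eliminates the faces. With at most one face it gives the first alternative.\<close>

lemma planar_edge_bound:
  assumes "V \<noteq> {}" and g: "\<And>S. S \<subseteq> E \<Longrightarrow> card S < g \<Longrightarrow> forest S"
  shows "card E + 1 \<le> card V \<or> g * (card E + 2) \<le> 2 * card E + g * card V"
proof (cases "card (faces E) \<ge> 2")
  case False
  then show ?thesis using euler_inequality[OF assms(1)] by linarith
next
  case True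
  have "g * card (faces E) = (\<Sum>U\<in>faces E. g)" by simp
  also have "\<dots> \<le> (\<Sum>U\<in>faces E. card {e \<in> E. touches U e})"
    using face_touches_many[OF _ True g] by (intro sum_mono) blast
  also have "\<dots> = (\<Sum>e\<in>E. card {U \<in> faces E. touches U e})"
    by (rule sum_multicount_gen) (simp_all add: finite_E finite_faces)
  also have "\<dots> \<le> (\<Sum>e\<in>E. 2)"
  proof (rule sum_mono)
    fix e assume "e \<in> E"
    then show "card {U \<in> faces E. touches U e} \<le> 2"
      using faces_touching_edge(2)[of "E - {e}" e] by (simp add: insert_absorb)
  qed
  finally have "g * card (faces E) \<le> 2 * card E" by simp
  moreover have "g * (card E + 2) \<le> g * (card V + card (faces E))"
    using euler_inequality[OF assms(1)] by (rule mult_le_mono2)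
  ultimately show ?thesis by (simp add: distrib_left)
qed

end

section \<open>Edge bounds for planar graphs\<close>

lemma planar_imp_plane_drawing:
  fixes V :: "'a set"
  assumes "simple_graph V E" "planar V E"
  obtains pos \<gamma> where "plane_drawing V E pos \<gamma>"
proof -
  have "\<exists>pos \<gamma>. plane_drawing V E pos \<gamma>"
    using assms(2) unfolding planar_def
  proof (elim exE)
    fix pos :: "'a \<Rightarrow> complex" and \<gamma> :: "'a set \<Rightarrow> real \<Rightarrow> complex"
    assume d: "inj_on pos V \<and>
      (\<forall>e\<in>E. arc (\<gamma> e) \<and>
         (\<exists>u v. e = {u, v} \<and> pathstart (\<gamma> e) = pos u \<and> pathfinish (\<gamma> e) = pos v) \<and>
         path_image (\<gamma> e) \<inter> pos ` V \<subseteq> pos ` e) \<and>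
      (\<forall>e\<in>E. \<forall>e'\<in>E. e \<noteq> e' \<longrightarrow> path_image (\<gamma> e) \<inter> path_image (\<gamma> e') \<subseteq> pos ` (e \<inter> e'))"
    have "plane_drawing V E pos \<gamma>"
    proof
      show "finite V" "\<And>e. e \<in> E \<Longrightarrow> e \<subseteq> V"
        using assms(1) unfolding simple_graph_def by auto
    qed (use d in simp_all)
    then show ?thesis by blast
  qed
  then show ?thesis using that by blast
qed

lemma planar_subgraph:
  assumes "simple_graph V E" "planar V E" "V' \<subseteq> V" "E' \<subseteq> E"
  shows "planar V' E'"
proof -
  obtain pos \<gamma> where "plane_drawing V E pos \<gamma>" using planar_imp_plane_drawing[OF assms(1,2)] .
  then interpret plane_drawing V E pos \<gamma> .
  show ?thesis
    unfolding planar_def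
  proof (rule exI[of _ pos], rule exI[of _ \<gamma>], intro conjI ballI impI)
    show "inj_on pos V'" using inj_pos assms(3) by (rule inj_on_subset)
  next
    fix e assume "e \<in> E'"
    then have e: "e \<in> E" using assms(4) by blast
    show "arc (\<gamma> e)" using e by (rule arc_edge)
    show "\<exists>u v. e = {u, v} \<and> pathstart (\<gamma> e) = pos u \<and> pathfinish (\<gamma> e) = pos v"
      using e by (rule edge_ends)
    show "path_image (\<gamma> e) \<inter> pos ` V' \<subseteq> pos ` e" using edge_vertices[OF e] assms(3) by blast
  next
    fix e e' assume "e \<in> E'" "e' \<in> E'" "e \<noteq> e'"
    then show "path_image (\<gamma> e) \<inter> path_image (\<gamma> e') \<subseteq> pos ` (e \<inter> e')"
      using assms(4) by (intro edge_edge) auto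
  qed
qed

text \<open>Two distinct edges of the same size are not nested, so one of them has an endpoint
  outside the other.\<close>

lemma forest_if_card_less_3:
  assumes E: "\<And>e. e \<in> S \<Longrightarrow> card e = 2" and S: "finite S" "card S < 3"
  shows "forest S"
  unfolding forest_def
proof (intro allI impI)
  fix T assume T: "T \<subseteq> S" "T \<noteq> {}"
  then obtain e where e: "e \<in> T" by blast
  have "finite T" "card T < 3" using T S finite_subset card_mono[of S T] by auto
  show "\<exists>e\<in>T. \<exists>v\<in>e. \<forall>f\<in>T. v \<in> f \<longrightarrow> f = e"
  proof (cases "T = {e}")
    case True
    have "e \<noteq> {}" using E[of e] e T by auto
    then show ?thesis using True by blast
  next
    case False
    then obtain f where f: "f \<in> T" "f \<noteq> e" using e by blast
    have Tef: "T = {e, f}"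
    proof (rule ccontr)
      assume "T \<noteq> {e, f}"
      then obtain h where "h \<in> T" "h \<noteq> e" "h \<noteq> f" using e f by blast
      then have "card {e, f, h} \<le> card T" using e f \<open>finite T\<close> by (intro card_mono) auto
      then show False using \<open>card T < 3\<close> f \<open>h \<noteq> e\<close> \<open>h \<noteq> f\<close> by simp
    qed
    have "card e = 2" "card f = 2" using E e f T by auto
    then have "\<not> e \<subseteq> f" using f(2) by (metis card_subset_eq card.infinite zero_neq_numeral)
    then show ?thesis using Tef by blast
  qed
qed

text \<open>Without a leaf, an edge \<open>{a, b}\<close> has further edges \<open>{a, b'}\<close>
  at \<open>a\<close> and \<open>{a', b}\<close> at \<open>b\<close>, and a second edge at
  \<open>b'\<close>. The last one is new because \<open>b'\<close> lies in neither
  \<open>{a, b}\<close> nor \<open>{a', b}\<close>, so there would be four edges.\<close>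

lemma bipartite_forest_if_card_less_4:
  assumes AB: "A \<inter> B = {}" and E: "\<And>e. e \<in> S \<Longrightarrow> \<exists>a\<in>A. \<exists>b\<in>B. e = {a, b}"
    and S: "finite S" "card S < 4"
  shows "forest S"
  unfolding forest_def
proof (intro allI impI)
  fix T assume T: "T \<subseteq> S" "T \<noteq> {}"
  have cT: "finite T" "card T < 4" using T S finite_subset card_mono[of S T] by auto
  show "\<exists>e\<in>T. \<exists>v\<in>e. \<forall>f\<in>T. v \<in> f \<longrightarrow> f = e"
  proof (rule ccontr)
    assume "\<not> ?thesis"
    then have nl: "\<exists>f\<in>T. v \<in> f \<and> f \<noteq> e" if "e \<in> T" "v \<in> e" for e v using that by blast
    obtain e where e: "e \<in> T" using T by blast
    then obtain a b where ab: "a \<in> A" "b \<in> B" "e = {a, b}" using E T by blast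
    obtain f where f: "f \<in> T" "a \<in> f" "f \<noteq> e" using nl[OF e, of a] ab by blast
    obtain a1 b' where "a1 \<in> A" "b' \<in> B" "f = {a1, b'}" using E f T by blast
    then have b': "b' \<in> B" "f = {a, b'}" "b' \<noteq> b" using f ab AB by auto
    obtain h where h: "h \<in> T" "b \<in> h" "h \<noteq> e" using nl[OF e, of b] ab by blast
    obtain a' b1 where "a' \<in> A" "b1 \<in> B" "h = {a', b1}" using E h T by blast
    then have a': "a' \<in> A" "h = {a', b}" using h ab AB by auto
    have "b' \<notin> h" using a' b' AB by auto
    moreover have "b' \<notin> e" using ab b' AB by auto
    moreover obtain k where k: "k \<in> T" "b' \<in> k" "k \<noteq> f" using nl[OF f(1), of b'] b' by blast
    ultimately have "distinct [e, f, h, k]" using f h b' by auto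
    then have "card (set [e, f, h, k]) = 4" by (simp only: distinct_card) simp
    moreover have "card (set [e, f, h, k]) \<le> card T" using e f h k cT by (intro card_mono) auto
    ultimately show False using cT by simp
  qed
qed

text \<open>This is \<open>planar_edge_bound\<close> with \<open>g = 3\<close>. The first bound is
  weaker but also covers one or two vertices.\<close>

lemma planar_card_edges:
  assumes G: "simple_graph V E" "planar V E" and "V \<noteq> {}"
  shows "card E + 3 \<le> 3 * card V" and "card V \<ge> 3 \<Longrightarrow> card E + 6 \<le> 3 * card V"
proof -
  obtain pos \<gamma> where "plane_drawing V E pos \<gamma>" using planar_imp_plane_drawing[OF G] .
  then interpret plane_drawing V E pos \<gamma> .
  have "card E + 1 \<le> card V \<or> 3 * (card E + 2) \<le> 2 * card E + 3 * card V"
  proof (rule planar_edge_bound[OF \<open>V \<noteq> {}\<close>])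
    fix S assume "S \<subseteq> E" "card S < 3"
    then show "forest S"
      using G(1) finite_subset[OF _ finite_E, of S] unfolding simple_graph_def by (intro forest_if_card_less_3) auto
  qed
  moreover have "card V \<ge> 1" using assms(3) finite_V by (simp add: Suc_le_eq card_gt_0_iff)
  ultimately show "card E + 3 \<le> 3 * card V" "card V \<ge> 3 \<Longrightarrow> card E + 6 \<le> 3 * card V"
    by presburger+
qed

text \<open>Here \<open>planar_edge_bound\<close> is used with \<open>g = 4\<close>, since the
  shortest possible cycle has four edges.\<close>

lemma bipartite_planar_card_edges:
  assumes G: "simple_graph V E" "planar V E"
    and AB: "A \<inter> B = {}" "\<And>e. e \<in> E \<Longrightarrow> \<exists>a\<in>A. \<exists>b\<in>B. e = {a, b}"
  shows "card E \<le> 2 * card V"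
proof (cases "V = {}")
  case True
  then have "E = {}" using G(1) unfolding simple_graph_def by fastforce
  then show ?thesis by simp
next
  case False
  obtain pos \<gamma> where "plane_drawing V E pos \<gamma>" using planar_imp_plane_drawing[OF G] .
  then interpret plane_drawing V E pos \<gamma> .
  have "card E + 1 \<le> card V \<or> 4 * (card E + 2) \<le> 2 * card E + 4 * card V"
  proof (rule planar_edge_bound[OF False])
    fix S assume "S \<subseteq> E" "card S < 4"
    then show "forest S"
      using AB finite_subset[OF _ finite_E, of S] by (intro bipartite_forest_if_card_less_4[of A B]) auto
  qed
  then show ?thesis by presburger
qed

section \<open>Degrees, edge counts and embedded double stars\<close>

text \<open>Hall's condition for two sets with demands \<open>m\<close> and \<open>k\<close>.
  \<open>B\<close> is taken from \<open>Q - P\<close> as far as possible, the deficit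
  \<open>C\<close> comes from \<open>P \<inter> Q\<close>, and \<open>A\<close> from what remains of
  \<open>P\<close>.\<close>

lemma disjoint_subsets_of_card:
  assumes "finite P" "finite Q" "m \<le> card P" "k \<le> card Q" "m + k \<le> card (P \<union> Q)"
  obtains A B where "A \<subseteq> P" "B \<subseteq> Q" "card A = m" "card B = k" "A \<inter> B = {}"
proof (cases "k \<le> card (Q - P)")
  case True
  then obtain B where "B \<subseteq> Q - P" "card B = k" using obtain_subset_with_card_n by metis
  moreover obtain A where "A \<subseteq> P" "card A = m" using assms(3) obtain_subset_with_card_n by metis
  ultimately show ?thesis using that[of A B] by blast
next
  case False
  have cQ: "card Q = card (Q - P) + card (P \<inter> Q)"
    using card_Int_Diff[of Q P] assms by (simp add: Int_commute)
  have cPQ: "card (P \<union> Q) = card P + card (Q - P)"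
    using card_Un_disjoint[of P "Q - P"] assms by (simp add: Un_Diff_cancel)
  have "k - card (Q - P) \<le> card (P \<inter> Q)" using cQ assms by linarith
  then obtain C where C: "C \<subseteq> P \<inter> Q" "card C = k - card (Q - P)" using obtain_subset_with_card_n by metis
  have finC: "finite C" using C(1) assms(1) by (meson finite_Int finite_subset)
  have "card (P - C) = card P - card C" using C(1) finC by (intro card_Diff_subset) auto
  then have "m \<le> card (P - C)" using C(2) cPQ assms False by linarith
  then obtain A where A: "A \<subseteq> P - C" "card A = m" using obtain_subset_with_card_n by metis
  have "card ((Q - P) \<union> C) = card (Q - P) + card C"
    using finC C(1) assms by (intro card_Un_disjoint) auto
  then have "card ((Q - P) \<union> C) = k" using C False by simp
  then show ?thesis using that[of A "(Q - P) \<union> C"] A C by blast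
qed

locale finite_simple_graph =
  fixes V :: "'a set" and E :: "'a set set"
  assumes simple: "simple_graph V E"
begin

definition nbrs :: "'a \<Rightarrow> 'a set" where
  "nbrs v = {u. {v, u} \<in> E}"

abbreviation deg :: "'a \<Rightarrow> nat" where
  "deg v \<equiv> card (nbrs v)"

lemma finite_V: "finite V" and edge: "e \<in> E \<Longrightarrow> e \<subseteq> V \<and> card e = 2"
  using simple unfolding simple_graph_def by auto

lemma finite_E: "finite E"
proof (rule finite_subset)
  show "E \<subseteq> Pow V" using edge by blast
  show "finite (Pow V)" using finite_V by simp
qed

lemma nbrs_sym: "u \<in> nbrs v \<longleftrightarrow> v \<in> nbrs u"
  unfolding nbrs_def by (simp add: insert_commute)

lemma nbrs_subset: "nbrs v \<subseteq> V"
  unfolding nbrs_def using edge by blast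

lemma finite_nbrs: "finite (nbrs v)"
  using nbrs_subset finite_V by (rule finite_subset)

lemma nbrs_irrefl: "v \<notin> nbrs v"
  unfolding nbrs_def using edge[of "{v, v}"] by auto

lemma edge_eq_insert_nbr:
  assumes "e \<in> E" "v \<in> e"
  obtains u where "e = {v, u}" "u \<in> nbrs v" "u \<noteq> v"
proof -
  have "card e = 2" using edge assms by blast
  then obtain a b where "e = {a, b}" "a \<noteq> b" unfolding card_2_iff by blast
  then have "e = {v, a} \<and> a \<noteq> v \<or> e = {v, b} \<and> b \<noteq> v" using assms(2) by auto
  then show ?thesis using that assms(1) unfolding nbrs_def by auto
qed

lemma card_nbrs_Int:
  assumes "v \<in> X"
  shows "card (nbrs v \<inter> X) = card {e \<in> E. e \<subseteq> X \<and> v \<in> e}"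
proof (rule bij_betw_same_card)
  show "bij_betw (\<lambda>u. {v, u}) (nbrs v \<inter> X) {e \<in> E. e \<subseteq> X \<and> v \<in> e}"
  proof (rule bij_betw_imageI)
    show "inj_on (\<lambda>u. {v, u}) (nbrs v \<inter> X)"
      by (auto simp: inj_on_def doubleton_eq_iff)
    show "(\<lambda>u. {v, u}) ` (nbrs v \<inter> X) = {e \<in> E. e \<subseteq> X \<and> v \<in> e}"
    proof (intro equalityI subsetI)
      fix e assume "e \<in> {e \<in> E. e \<subseteq> X \<and> v \<in> e}"
      then have e: "e \<in> E" "e \<subseteq> X" "v \<in> e" by auto
      obtain u where u: "e = {v, u}" "u \<in> nbrs v" using edge_eq_insert_nbr[OF e(1,3)] by metis
      then show "e \<in> (\<lambda>u. {v, u}) ` (nbrs v \<inter> X)" using e(2) by blast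
    qed (use assms nbrs_def in auto)
  qed
qed

lemma deg_eq_card_edges: "deg v = card {e \<in> E. v \<in> e}"
proof (cases "v \<in> V")
  case True
  have "nbrs v \<inter> V = nbrs v" using nbrs_subset by blast
  moreover have "{e \<in> E. e \<subseteq> V \<and> v \<in> e} = {e \<in> E. v \<in> e}" using edge by blast
  ultimately show ?thesis using card_nbrs_Int[OF True] by simp
next
  case False
  then have "nbrs v = {}" "{e \<in> E. v \<in> e} = {}" unfolding nbrs_def using edge by blast+
  then show ?thesis by (simp only: card.empty)
qed

text \<open>The handshake lemma for the subgraph induced on \<open>X\<close>, by counting pairs of a
  vertex and an edge containing it.\<close>

lemma sum_card_nbrs_Int:
  assumes "X \<subseteq> V"
  shows "(\<Sum>v\<in>X. card (nbrs v \<inter> X)) = 2 * card {e \<in> E. e \<subseteq> X}"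
proof -
  let ?F = "{e \<in> E. e \<subseteq> X}"
  have fin: "finite X" "finite ?F" using assms finite_V finite_E finite_subset by auto
  have "(\<Sum>v\<in>X. card (nbrs v \<inter> X)) = (\<Sum>v\<in>X. card {e \<in> ?F. v \<in> e})"
    by (intro sum.cong) (auto simp: card_nbrs_Int conj_assoc)
  also have "\<dots> = (\<Sum>e\<in>?F. card {v \<in> X. v \<in> e})"
    by (rule sum_multicount_gen) (use fin in auto)
  also have "\<dots> = (\<Sum>e\<in>?F. 2)"
  proof (rule sum.cong)
    fix e assume "e \<in> ?F"
    then have "{v \<in> X. v \<in> e} = e" "card e = 2" using edge by auto
    then show "card {v \<in> X. v \<in> e} = 2" by simp
  qed simp
  finally show ?thesis by simp
qed

lemma sum_deg: "(\<Sum>v\<in>V. deg v) = 2 * card E"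
proof -
  have "nbrs v \<inter> V = nbrs v" for v using nbrs_subset by blast
  moreover have "{e \<in> E. e \<subseteq> V} = E" using edge by blast
  ultimately show ?thesis using sum_card_nbrs_Int[of V] by simp
qed

lemma sum_card_nbrs_swap:
  assumes "finite A" "finite B"
  shows "(\<Sum>a\<in>A. card (nbrs a \<inter> B)) = (\<Sum>b\<in>B. card (nbrs b \<inter> A))"
proof -
  have "(\<Sum>a\<in>A. card {b \<in> B. b \<in> nbrs a}) = (\<Sum>b\<in>B. card {a \<in> A. b \<in> nbrs a})"
    by (rule sum_multicount_gen) (use assms in auto)
  moreover have "{b \<in> B. b \<in> nbrs a} = nbrs a \<inter> B" for a by blast
  moreover have "{a \<in> A. b \<in> nbrs a} = nbrs b \<inter> A" for b using nbrs_sym by blast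
  ultimately show ?thesis by simp
qed

lemma induced_subgraph:
  assumes "X \<subseteq> V" "F \<subseteq> E" "\<And>e. e \<in> F \<Longrightarrow> e \<subseteq> X"
  shows "simple_graph X F"
  unfolding simple_graph_def using finite_subset[OF assms(1) finite_V] assms(2,3) edge by auto

text \<open>As \<open>A\<close> and \<open>B\<close> are disjoint, the sum counts each edge between
  them once, and these edges form a bipartite planar graph on \<open>A \<union> B\<close>.\<close>

lemma sum_card_nbrs_bipartite:
  assumes "planar V E" "A \<subseteq> V" "B \<subseteq> V" "A \<inter> B = {}"
  shows "(\<Sum>a\<in>A. card (nbrs a \<inter> B)) \<le> 2 * (card A + card B)"
proof -
  have fin: "finite A" "finite B"
    using finite_subset[OF assms(2) finite_V] finite_subset[OF assms(3) finite_V] by simp_all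
  define F where "F = {e \<in> E. \<exists>a\<in>A. \<exists>b\<in>B. e = {a, b}}"
  have "(\<Sum>a\<in>A. card (nbrs a \<inter> B)) = card (SIGMA a:A. nbrs a \<inter> B)"
    using fin by (intro card_SigmaI[symmetric]) auto
  also have "\<dots> \<le> card F"
  proof (rule card_inj_on_le)
    show "inj_on (\<lambda>(a, b). {a, b}) (SIGMA a:A. nbrs a \<inter> B)"
      using assms(4) by (auto simp: inj_on_def doubleton_eq_iff)
    show "(\<lambda>(a, b). {a, b}) ` (SIGMA a:A. nbrs a \<inter> B) \<subseteq> F"
      unfolding F_def nbrs_def by auto
    show "finite F" unfolding F_def using finite_E by simp
  qed
  also have "\<dots> \<le> 2 * card (A \<union> B)"
  proof (rule bipartite_planar_card_edges[OF _ _ assms(4)])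
    show "simple_graph (A \<union> B) F" using assms by (intro induced_subgraph) (auto simp: F_def)
    show "planar (A \<union> B) F" using assms by (intro planar_subgraph[OF simple assms(1)]) (auto simp: F_def)
  qed (auto simp: F_def)
  also have "card (A \<union> B) = card A + card B" using fin assms(4) by (rule card_Un_disjoint)
  finally show ?thesis .
qed

text \<open>The embedding is indexing into the list \<open>x # y # as @ bs\<close>, whose order
  matches the numbering of the double star: backbone, leaves at 0, leaves at 1.\<close>

lemma contains_double_star:
  assumes xy: "y \<in> nbrs x" and A: "A \<subseteq> nbrs x - {y}" "card A = m"
    and B: "B \<subseteq> nbrs y - {x}" "card B = k" and AB: "A \<inter> B = {}"
  shows "contains_subgraph V E (double_star_V m k) (double_star_E m k)"
proof -
  have fin: "finite A" "finite B" using A B finite_nbrs by (meson finite_Diff finite_subset)+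
  obtain as where as: "set as = A" "distinct as" using finite_distinct_list[OF fin(1)] by blast
  obtain bs where bs: "set bs = B" "distinct bs" using finite_distinct_list[OF fin(2)] by blast
  have len: "length as = m" "length bs = k" using as bs A B distinct_card by metis+
  let ?l = "x # y # as @ bs"
  have "x \<noteq> y" using xy nbrs_irrefl by metis
  then have dist: "distinct ?l" using as bs A B AB nbrs_irrefl[of x] nbrs_irrefl[of y] by auto
  have ll: "length ?l = m + k + 2" using len by simp
  have inA: "?l ! i \<in> A" if "2 \<le> i" "i < m + 2" for i
  proof -
    have "?l ! i = as ! (i - 2)" using that len by (simp add: nth_Cons nth_append numeral_2_eq_2 split: nat.split) 
    moreover have "as ! (i - 2) \<in> set as" using that len by (intro nth_mem) linarith
    ultimately show ?thesis using as by simp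
  qed
  have inB: "?l ! i \<in> B" if "m + 2 \<le> i" "i < m + k + 2" for i
  proof -
    have "?l ! i = bs ! (i - 2 - m)" using that len by (simp add: nth_Cons nth_append numeral_2_eq_2 split: nat.split)
    moreover have "bs ! (i - 2 - m) \<in> set bs" using that len by (intro nth_mem) linarith
    ultimately show ?thesis using bs by simp
  qed
  show ?thesis
    unfolding contains_subgraph_def
  proof (intro exI conjI ballI)
    show "inj_on (\<lambda>i. ?l ! i) (double_star_V m k)"
      unfolding double_star_V_def by (rule inj_on_nth[OF dist]) (unfold ll, simp)
    have "y \<in> V" by (rule subsetD[OF nbrs_subset xy])
    moreover have "x \<in> V" by (rule subsetD[OF nbrs_subset nbrs_sym[THEN iffD1, OF xy]])
    moreover have "set as \<subseteq> V" "set bs \<subseteq> V"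
      unfolding as(1) bs(1) using A(1) B(1) nbrs_subset by (meson Diff_subset subset_trans)+
    ultimately have "set ?l \<subseteq> V" by simp
    moreover have "(\<lambda>i. ?l ! i) ` {..<m + k + 2} \<subseteq> set ?l"
      using nth_mem[of _ ?l] unfolding ll by blast
    ultimately show "(\<lambda>i. ?l ! i) ` double_star_V m k \<subseteq> V"
      unfolding double_star_V_def by (rule subset_trans[rotated])
    fix e assume "e \<in> double_star_E m k"
    then consider "e = {0, 1}" | i where "e = {0, i}" "2 \<le> i" "i < m + 2"
      | i where "e = {1, i}" "m + 2 \<le> i" "i < m + k + 2"
      unfolding double_star_E_def by blast
    then show "(\<lambda>i. ?l ! i) ` e \<in> E"
    proof cases
      case 1
      then show ?thesis using xy unfolding nbrs_def by simp
    next
      case 2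
      then have "?l ! i \<in> nbrs x" using inA A by blast
      then show ?thesis using 2(1) unfolding nbrs_def by simp
    next
      case 3
      then have "?l ! i \<in> nbrs y" using inB B by blast
      then show ?thesis using 3(1) unfolding nbrs_def by simp
    qed
  qed
qed

text \<open>The leaves are chosen from the neighbours of \<open>x\<close> other than
  \<open>y\<close> and those of \<open>y\<close> other than \<open>x\<close>. Their union has
  \<open>deg x + deg y - 2\<close> elements minus the common neighbours, so the last hypothesis says
  that it has at least \<open>m + k\<close>.\<close>

lemma contains_double_star_if_deg:
  assumes xy: "y \<in> nbrs x" and "m < deg x" "k < deg y"
    and "card (nbrs x \<inter> nbrs y) + m + k + 2 \<le> deg x + deg y"
  shows "contains_subgraph V E (double_star_V m k) (double_star_E m k)"
proof -
  let ?P = "nbrs x - {y}" and ?Q = "nbrs y - {x}"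
  have "x \<in> nbrs y" using xy nbrs_sym by blast
  then have cP: "card ?P + 1 = deg x" "card ?Q + 1 = deg y"
    using xy finite_nbrs card_Suc_Diff1 by fastforce+
  have "?P \<inter> ?Q = nbrs x \<inter> nbrs y" using nbrs_irrefl by blast
  then have "card ?P + card ?Q = card (?P \<union> ?Q) + card (nbrs x \<inter> nbrs y)"
    using card_Un_Int[of ?P ?Q] finite_nbrs by simp
  then have mk: "m \<le> card ?P" "k \<le> card ?Q" "m + k \<le> card (?P \<union> ?Q)" using cP assms by linarith+
  have fin: "finite ?P" "finite ?Q" using finite_nbrs by simp_all
  obtain A B where "A \<subseteq> ?P" "B \<subseteq> ?Q" "card A = m" "card B = k" "A \<inter> B = {}"
    using disjoint_subsets_of_card[OF fin mk] .
  then show ?thesis using contains_double_star[OF xy] by blast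
qed

end

section \<open>Discharging\<close>

lemma contains_subgraph_mono:
  assumes "contains_subgraph V' E' VF EF" "V' \<subseteq> V" "E' \<subseteq> E"
  shows "contains_subgraph V E VF EF"
proof -
  obtain f where f: "inj_on f VF" "f ` VF \<subseteq> V'" "\<forall>e\<in>EF. f ` e \<in> E'"
    using assms(1) unfolding contains_subgraph_def by (elim exE conjE)
  have "f ` VF \<subseteq> V" using f(2) assms(2) by (rule subset_trans)
  then show ?thesis unfolding contains_subgraph_def using f(1,3) assms(3) by (intro exI[of _ f]) auto
qed

locale star34_free_planar = finite_simple_graph +
  assumes planar: "planar V E"
    and star_free: "\<not> contains_subgraph V E (double_star_V 3 4) (double_star_E 3 4)"
begin

lemma in_V_if_deg_pos:
  assumes "0 < deg v"
  shows "v \<in> V"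
proof -
  obtain u where "u \<in> nbrs v" using assms by (metis card.empty ex_in_conv less_irrefl)
  then have "v \<in> nbrs u" by (rule nbrs_sym[THEN iffD1])
  then show ?thesis by (rule subsetD[OF nbrs_subset])
qed

text \<open>With \<open>m = 3\<close> and \<open>k = 4\<close>, one common neighbour fewer would
  give \<open>card (nbrs x \<inter> nbrs y) + 9 \<le> deg x + deg y\<close>, where 9 is 3 + 4 + 2,
  and hence the forbidden star.\<close>

lemma common_nbrs_lower:
  assumes "y \<in> nbrs x" "4 \<le> deg x" "5 \<le> deg y"
  shows "deg x + deg y \<le> card (nbrs x \<inter> nbrs y) + 8"
  using contains_double_star_if_deg[of y x 3 4] assms star_free by linarith

lemma common_nbrs_upper:
  assumes "y \<in> nbrs x"
  shows "card (nbrs x \<inter> nbrs y) + 1 \<le> deg x"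
proof -
  have "nbrs x \<inter> nbrs y \<subseteq> nbrs x - {y}" using nbrs_irrefl by blast
  then have "card (nbrs x \<inter> nbrs y) \<le> card (nbrs x - {y})" using finite_nbrs by (intro card_mono) auto
  moreover have "card (nbrs x - {y}) < deg x" using assms finite_nbrs by (intro card_Diff1_less) auto
  ultimately show ?thesis by simp
qed

text \<open>If \<open>deg x\<close> were at least 4, the lower bound would force
  \<open>deg x\<close> common neighbours, but \<open>y\<close> is a neighbour of \<open>x\<close>
  that is not common.\<close>

lemma deg_nbr_of_deg_ge_8:
  assumes "x \<in> nbrs y" "8 \<le> deg y"
  shows "deg x \<le> 3"
  using common_nbrs_lower[of y x] common_nbrs_upper[of y x] assms nbrs_sym[of x y] by linarith

text \<open>For \<open>deg y = 7\<close> the lower bound is \<open>deg x - 1\<close>, so all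
  neighbours of \<open>x\<close> except \<open>y\<close> are common.\<close>

lemma nbrs_of_nbr_of_deg_7:
  assumes "x \<in> nbrs y" "deg y = 7" "4 \<le> deg x"
  shows "nbrs x \<subseteq> insert y (nbrs y)"
proof -
  have y: "y \<in> nbrs x" using assms(1) nbrs_sym by blast
  have "nbrs x \<inter> nbrs y = nbrs x - {y}"
  proof (rule card_seteq)
    show "nbrs x \<inter> nbrs y \<subseteq> nbrs x - {y}" using nbrs_irrefl by blast
    have "card (nbrs x - {y}) < deg x" using y finite_nbrs by (intro card_Diff1_less) auto
    then show "card (nbrs x - {y}) \<le> card (nbrs x \<inter> nbrs y)"
      using common_nbrs_lower[OF y] assms by linarith
  qed (simp add: finite_nbrs)
  then show ?thesis by blast
qed

text \<open>Neighbours of degree at least 4 have no neighbours outside the closed neighbourhood. So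
  an edge counted here either has an end in \<open>D\<close>, giving at most
  \<open>3 * card D\<close>, or lies in \<open>insert y B\<close>, giving at most
  \<open>3 * card B\<close> by planarity; the two sizes add up to 7.\<close>

lemma card_edges_meeting_closed_nbrs_of_deg_7:
  assumes y: "deg y = 7"
  shows "card {e \<in> E. e \<inter> insert y (nbrs y) \<noteq> {}} \<le> 21"
proof -
  define D where "D = {x \<in> nbrs y. deg x \<le> 3}"
  define B where "B = {x \<in> nbrs y. 4 \<le> deg x}"
  have DB: "nbrs y = D \<union> B" "D \<inter> B = {}" unfolding D_def B_def by auto
  have fin: "finite D" "finite B" unfolding D_def B_def using finite_nbrs by simp_all
  have card7: "card D + card B = 7" using y DB fin card_Un_disjoint by metis
  have yB: "y \<notin> B" unfolding B_def using nbrs_irrefl by blast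
  have "y \<in> V" using y by (intro in_V_if_deg_pos) simp
  then have BV: "insert y B \<subseteq> V" unfolding B_def using nbrs_subset[of y] by blast
  let ?I = "{e \<in> E. e \<subseteq> insert y B}"
  have sI: "simple_graph (insert y B) ?I" by (rule induced_subgraph[OF BV]) simp_all
  have pI: "planar (insert y B) ?I" by (rule planar_subgraph[OF simple planar BV]) simp
  have I: "card ?I \<le> 3 * card B"
    using planar_card_edges(1)[OF sI pI] fin yB by simp
  have sub: "{e \<in> E. e \<inter> insert y (nbrs y) \<noteq> {}} \<subseteq> ?I \<union> (\<Union>d\<in>D. {e \<in> E. d \<in> e})"
  proof
    fix e assume "e \<in> {e \<in> E. e \<inter> insert y (nbrs y) \<noteq> {}}"
    then obtain x where x: "e \<in> E" "x \<in> e" "x = y \<or> x \<in> D \<or> x \<in> B" using DB(1) by auto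
    obtain u where u: "e = {x, u}" "u \<in> nbrs x" using edge_eq_insert_nbr[OF x(1,2)] by metis
    show "e \<in> ?I \<union> (\<Union>d\<in>D. {e \<in> E. d \<in> e})"
    proof (cases "x \<in> D \<or> u \<in> D")
      case True
      then show ?thesis using x(1) u(1) by auto
    next
      case False
      have "u \<in> insert y (nbrs y)"
      proof (cases "x = y")
        case True
        then show ?thesis using u(2) by simp
      next
        case False
        then have "x \<in> nbrs y" "4 \<le> deg x" using x(3) \<open>\<not> (x \<in> D \<or> u \<in> D)\<close> unfolding B_def by auto
        then show ?thesis using nbrs_of_nbr_of_deg_7 y u(2) by blast
      qed
      then have "e \<subseteq> insert y B" using False x(3) u(1) DB(1) by blast
      then show ?thesis using x(1) by blast
    qed
  qed
  have "card (\<Union>d\<in>D. {e \<in> E. d \<in> e}) \<le> (\<Sum>d\<in>D. card {e \<in> E. d \<in> e})"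
    using fin(1) by (rule card_UN_le)
  also have "\<dots> \<le> (\<Sum>d\<in>D. 3)"
  proof (rule sum_mono)
    fix d assume "d \<in> D"
    then have "deg d \<le> 3" unfolding D_def by blast
    then show "card {e \<in> E. d \<in> e} \<le> 3" using deg_eq_card_edges[of d] by simp
  qed
  finally have U: "card (\<Union>d\<in>D. {e \<in> E. d \<in> e}) \<le> 3 * card D" by simp
  have "card {e \<in> E. e \<inter> insert y (nbrs y) \<noteq> {}} \<le> card (?I \<union> (\<Union>d\<in>D. {e \<in> E. d \<in> e}))"
    using sub fin finite_E by (intro card_mono) auto
  also have "\<dots> \<le> card ?I + card (\<Union>d\<in>D. {e \<in> E. d \<in> e})" by (rule card_Un_le)
  also have "\<dots> \<le> 21" using I U card7 by linarith
  finally show ?thesis .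
qed

text \<open>Otherwise five neighbours of degree 6 share at least four neighbours each with \<open>y\<close>, which forces
  16 edges on the 7 vertices of the closed neighbourhood.\<close>
lemma card_small_nbrs_of_deg_6:
  assumes y: "deg y = 6" and no7: "\<And>v. deg v \<noteq> 7"
  shows "2 \<le> card {x \<in> nbrs y. deg x \<le> 5}"
proof (rule ccontr)
  assume less: "\<not> ?thesis"
  define Q where "Q = {x \<in> nbrs y. deg x = 6}"
  have "nbrs y \<subseteq> {x \<in> nbrs y. deg x \<le> 5} \<union> Q"
  proof
    fix x assume x: "x \<in> nbrs y"
    \<comment> \<open>Otherwise \<open>y\<close> would have degree at most 3.\<close>
    then have "\<not> 8 \<le> deg x" using deg_nbr_of_deg_ge_8[of y x] y nbrs_sym[of x y] by auto
    then have "deg x \<le> 5 \<or> deg x = 6" using no7[of x] by linarith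
    then show "x \<in> {x \<in> nbrs y. deg x \<le> 5} \<union> Q" using x unfolding Q_def by blast
  qed
  then have "deg y \<le> card ({x \<in> nbrs y. deg x \<le> 5} \<union> Q)"
    using finite_nbrs unfolding Q_def by (intro card_mono) auto
  also have "\<dots> \<le> card {x \<in> nbrs y. deg x \<le> 5} + card Q" by (rule card_Un_le)
  finally have Q5: "5 \<le> card Q" using y less by linarith
  define X where "X = insert y (nbrs y)"
  have "y \<in> V" using y by (intro in_V_if_deg_pos) simp
  then have XV: "X \<subseteq> V" unfolding X_def using nbrs_subset[of y] by blast
  have cX: "card X = 7" unfolding X_def using y finite_nbrs nbrs_irrefl by simp
  let ?I = "{e \<in> E. e \<subseteq> X}"
  have sI: "simple_graph X ?I" by (rule induced_subgraph[OF XV]) simp_all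
  have pI: "planar X ?I" by (rule planar_subgraph[OF simple planar XV]) simp
  have I: "card ?I \<le> 15"
    using planar_card_edges(2)[OF sI pI] cX by (cases "X = {}") simp_all
  \<comment> \<open>The 1 counts \<open>y\<close> itself, and the 4 is 6 + 6 - 8 from
    \<open>common_nbrs_lower\<close>.\<close>
  have low: "1 + (if x \<in> Q then 4 else 0) \<le> card (nbrs x \<inter> X)" if x: "x \<in> nbrs y" for x
  proof -
    have yx: "y \<in> nbrs x" using x nbrs_sym by blast
    have "insert y (nbrs x \<inter> nbrs y) \<subseteq> nbrs x \<inter> X" using yx unfolding X_def by blast
    then have "card (insert y (nbrs x \<inter> nbrs y)) \<le> card (nbrs x \<inter> X)"
      using finite_nbrs by (intro card_mono) auto
    moreover have "card (insert y (nbrs x \<inter> nbrs y)) = card (nbrs x \<inter> nbrs y) + 1"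
      using finite_nbrs nbrs_irrefl by simp
    moreover have "4 \<le> card (nbrs x \<inter> nbrs y)" if "x \<in> Q"
      using common_nbrs_lower[OF yx] that y unfolding Q_def by simp
    ultimately show ?thesis by auto
  qed
  have "nbrs y \<inter> Q = Q" unfolding Q_def by blast
  \<comment> \<open>The neighbours contribute at least 6 + 4 * 5 = 26 and \<open>y\<close> another
    6. The total 32 exceeds 30, twice the planar bound 15 for 7 vertices.\<close>
  then have "6 + 4 * card Q = (\<Sum>x\<in>nbrs y. 1 + (if x \<in> Q then 4 else 0))"
    using finite_nbrs y by (simp add: sum_Suc sum.If_cases)
  also have "\<dots> \<le> (\<Sum>x\<in>nbrs y. card (nbrs x \<inter> X))"
    using low by (rule sum_mono)
  finally have "26 \<le> (\<Sum>x\<in>nbrs y. card (nbrs x \<inter> X))" using Q5 by linarith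
  moreover have "nbrs y \<inter> X = nbrs y" unfolding X_def by blast
  ultimately have "32 \<le> (\<Sum>x\<in>X. card (nbrs x \<inter> X))"
    unfolding X_def using finite_nbrs nbrs_irrefl y by simp
  then show False using sum_card_nbrs_Int[OF XV] I by simp
qed

text \<open>The charges are multiplied by 7 and negative terms moved across, so that each degree
  class gives an inequality between natural numbers. \<open>T\<close> is the number of edges between
  \<open>H\<close> and \<open>L\<close>.\<close>

lemma edge_bound_if_no_deg_7:
  assumes no7: "\<And>v. deg v \<noteq> 7"
  shows "7 * card E \<le> 20 * card V"
proof -
  define H where "H = {v \<in> V. 8 \<le> deg v}"
  define S where "S = {v \<in> V. deg v = 6}"
  define M where "M = {v \<in> V. 4 \<le> deg v \<and> deg v \<le> 5}"
  define L where "L = {v \<in> V. deg v \<le> 3}"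
  note defs = H_def S_def M_def L_def
  have fin: "finite H" "finite S" "finite M" "finite L" unfolding defs using finite_V by simp_all
  have V: "V = H \<union> S \<union> (M \<union> L)"
  proof (intro equalityI subsetI)
    fix v assume "v \<in> V"
    moreover have "8 \<le> deg v \<or> deg v = 6 \<or> 4 \<le> deg v \<and> deg v \<le> 5 \<or> deg v \<le> 3"
      using no7[of v] by linarith
    ultimately show "v \<in> H \<union> S \<union> (M \<union> L)" unfolding defs by blast
  qed (auto simp: defs)
  have disj: "H \<inter> S = {}" "(H \<union> S) \<inter> (M \<union> L) = {}" "M \<inter> L = {}" "H \<inter> L = {}"
    unfolding defs by auto
  have split: "sum f V = sum f H + sum f S + (sum f M + sum f L)" for f :: "'a \<Rightarrow> nat"
    unfolding V using fin disj by (simp add: sum.union_disjoint)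
  define T where "T = (\<Sum>v\<in>L. card (nbrs v \<inter> H))"
  \<comment> \<open>Vertices of \<open>H\<close> have all their neighbours in
    \<open>L\<close>.\<close>
  have H: "sum deg H = T"
  proof -
    have "nbrs v \<inter> L = nbrs v" if "v \<in> H" for v
      using deg_nbr_of_deg_ge_8[of _ v] that nbrs_subset[of v] unfolding defs by blast
    then have "sum deg H = (\<Sum>v\<in>H. card (nbrs v \<inter> L))" by simp
    then show ?thesis unfolding T_def using sum_card_nbrs_swap fin by simp
  qed
  have "T \<le> 2 * (card L + card H)"
    unfolding T_def using disj by (intro sum_card_nbrs_bipartite[OF planar]) (auto simp: defs)
  then have T: "T \<le> 2 * card L + 2 * card H" by simp
  \<comment> \<open>The extreme case is degree 5 with all neighbours in \<open>S\<close>: 7 * 5 + 5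
    = 40.\<close>
  have M: "7 * sum deg M + (\<Sum>v\<in>M. card (nbrs v \<inter> S)) \<le> 40 * card M"
  proof -
    have "7 * deg v + card (nbrs v \<inter> S) \<le> 40" if "v \<in> M" for v
    proof -
      have "card (nbrs v \<inter> S) \<le> deg v" using finite_nbrs by (intro card_mono) auto
      moreover have "deg v \<le> 5" using that unfolding M_def by simp
      ultimately show ?thesis by linarith
    qed
    then have "(\<Sum>v\<in>M. 7 * deg v + card (nbrs v \<inter> S)) \<le> (\<Sum>v\<in>M. 40)" by (rule sum_mono)
    then show ?thesis by (simp add: sum.distrib sum_distrib_left)
  qed
  \<comment> \<open>a vertex of degree at most 3 pays 1 to each neighbour in \<open>H\<close> and 1/7 to each neighbour in \<open>S\<close>;
    the coefficient 5 instead of 7 leaves exactly what the bipartite bound \<open>T\<close> gives back\<close>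
  have L: "7 * sum deg L + (\<Sum>v\<in>L. card (nbrs v \<inter> S)) + 5 * T \<le> 36 * card L"
  proof -
    have "7 * deg v + card (nbrs v \<inter> S) + 5 * card (nbrs v \<inter> H) \<le> 36" if "v \<in> L" for v
    proof -
      have "card (nbrs v \<inter> S) + card (nbrs v \<inter> H) = card (nbrs v \<inter> S \<union> nbrs v \<inter> H)"
        using disj(1) finite_nbrs by (intro card_Un_disjoint[symmetric]) auto
      also have "\<dots> \<le> deg v" using finite_nbrs by (intro card_mono) auto
      finally have "card (nbrs v \<inter> S) + card (nbrs v \<inter> H) \<le> deg v" .
      moreover have "deg v \<le> 3" using that unfolding L_def by simp
      ultimately show ?thesis by linarith
    qed
    then have "(\<Sum>v\<in>L. 7 * deg v + card (nbrs v \<inter> S) + 5 * card (nbrs v \<inter> H)) \<le> (\<Sum>v\<in>L. 36)"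
      by (rule sum_mono)
    then show ?thesis unfolding T_def by (simp add: sum.distrib sum_distrib_left)
  qed
  \<comment> \<open>Each vertex of degree 6 lacks 2/7, which two neighbours of degree at most 5
    supply.\<close>
  have S: "2 * card S \<le> (\<Sum>v\<in>M. card (nbrs v \<inter> S)) + (\<Sum>v\<in>L. card (nbrs v \<inter> S))"
  proof -
    have "2 * card S = (\<Sum>v\<in>S. 2)" by simp
    also have "\<dots> \<le> (\<Sum>v\<in>S. card (nbrs v \<inter> (M \<union> L)))"
    proof (rule sum_mono)
      fix v assume "v \<in> S"
      then have "2 \<le> card {x \<in> nbrs v. deg x \<le> 5}"
        using no7 by (intro card_small_nbrs_of_deg_6) (auto simp: S_def)
      moreover have "{x \<in> nbrs v. deg x \<le> 5} = nbrs v \<inter> (M \<union> L)"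
        using nbrs_subset[of v] unfolding M_def L_def by auto
      ultimately show "2 \<le> card (nbrs v \<inter> (M \<union> L))" by simp
    qed
    also have "\<dots> = (\<Sum>v\<in>M \<union> L. card (nbrs v \<inter> S))"
      using fin by (intro sum_card_nbrs_swap) auto
    also have "\<dots> = (\<Sum>v\<in>M. card (nbrs v \<inter> S)) + (\<Sum>v\<in>L. card (nbrs v \<inter> S))"
      using fin disj by (intro sum.union_disjoint) auto
    finally show ?thesis .
  qed
  have "sum deg S = 6 * card S" unfolding S_def by simp
  then have "2 * card E = T + 6 * card S + (sum deg M + sum deg L)"
    using sum_deg split[of deg] H by simp
  moreover have "card V = card H + card S + (card M + card L)"
    using split[of "\<lambda>_. 1"] by simp
  \<comment> \<open>Adding \<open>M\<close>, \<open>L\<close> and \<open>S\<close> bounds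
    \<open>14 * card E\<close> by \<open>2 * T + 40 * (card S + card M) + 36 * card L\<close>. As
    \<open>2 * T\<close> is at most \<open>4 * card L + 4 * card H\<close>, this is at most
    \<open>40 * card V\<close>.\<close>
  ultimately show ?thesis using T M L S by linarith
qed

end

section \<open>Removal of degree-7 neighbourhoods and the Turan number\<close>

text \<open>Deleting the closed neighbourhood of a vertex of degree 7 removes 8 vertices and at most
  21 edges, and 7 * 21 = 147 is below 20 * 8 = 160. Without such a vertex the discharging bound
  applies.\<close>

lemma star34_free_planar_edge_bound:
  assumes "simple_graph V E" "planar V E"
    and "\<not> contains_subgraph V E (double_star_V 3 4) (double_star_E 3 4)"
  shows "7 * card E \<le> 20 * card V"
  using assms
proof (induction "card V" arbitrary: V E rule: less_induct)
  case less
  interpret star34_free_planar V E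
    using less.prems by unfold_locales
  show ?case
  proof (cases "\<exists>y. deg y = 7")
    case False
    then show ?thesis using edge_bound_if_no_deg_7 by blast
  next
    case True
    then obtain y where y: "deg y = 7" by blast
    define X where "X = insert y (nbrs y)"
    define E' where "E' = {e \<in> E. e \<inter> X = {}}"
    have "y \<in> V" using y by (intro in_V_if_deg_pos) simp
    then have XV: "X \<subseteq> V" unfolding X_def using nbrs_subset[of y] by blast
    have cX: "card X = 8" unfolding X_def using y finite_nbrs nbrs_irrefl by simp
    have finX: "finite X" unfolding X_def using finite_nbrs by simp
    have cV: "card V = card (V - X) + 8"
      using card_Diff_subset[OF finX XV] card_mono[OF finite_V XV] cX by simp
    have "simple_graph (V - X) E'"
      using edge by (intro induced_subgraph) (auto simp: E'_def)
    moreover have "planar (V - X) E'"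
      by (rule planar_subgraph[OF simple planar]) (auto simp: E'_def)
    moreover have "\<not> contains_subgraph (V - X) E' (double_star_V 3 4) (double_star_E 3 4)"
      using contains_subgraph_mono[of "V - X" E' _ _ V E] star_free E'_def by blast
    ultimately have IH: "7 * card E' \<le> 20 * card (V - X)"
      using cV by (intro less.hyps) auto
    have "E = E' \<union> {e \<in> E. e \<inter> X \<noteq> {}}" unfolding E'_def by blast
    then have "card E \<le> card E' + card {e \<in> E. e \<inter> X \<noteq> {}}" using card_Un_le by metis
    then show ?thesis
      using IH cV card_edges_meeting_closed_nbrs_of_deg_7[OF y] unfolding X_def by linarith
  qed
qed

theorem theorem1p1:
  fixes n :: nat
  assumes "n \<ge> 1"
  shows "real (planar_turan n (double_star_V 3 4) (double_star_E 3 4)) \<le> 20 / 7 * real n"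
proof -
  define A where "A = {card E | (V :: nat set) E. simple_graph V E \<and> card V = n \<and> planar V E \<and>
    \<not> contains_subgraph V E (double_star_V 3 4) (double_star_E 3 4)}"
  have bound: "a \<le> 20 * n div 7" if "a \<in> A" for a
    using that star34_free_planar_edge_bound unfolding A_def by fastforce
  have "Sup A \<le> 20 * n div 7"
  \<comment> \<open>On \<open>nat\<close> the supremum of the empty set is 0.\<close>
  proof (cases "A = {}")
    case False
    then show ?thesis using bound by (rule cSup_least)
  qed (simp add: Sup_nat_def)
  then have "7 * planar_turan n (double_star_V 3 4) (double_star_E 3 4) \<le> 20 * n"
    unfolding planar_turan_def A_def by linarith
  then show ?thesis by linarith
qed

end
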